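(* There is an absolute constant $C>0$ such that the following holds. Let $\mathsf{P}$ be a Markov transition matrix on a finite state space $\mathcal{X}$ with stationary distribution $\pi$ (with $\pi(x)>0$ for all $x$), and suppose that $\widetilde{\mathsf{P}}$ is an $\varepsilon$-corruption of $\mathsf{P}$. For any $\delta\in(0,1]$ and any distribution $\mu$ on $\mathcal{X}$, let $\pi_\delta$ and $\widetilde{\pi}_\delta$ be the stationary distributions of the PageRank chains $\mathsf{P}(\delta)=(1-\delta)\mathsf{P}+\delta\,\mathbf{1}^T\mu$ and $\widetilde{\mathsf{P}}(\delta)=(1-\delta)\widetilde{\mathsf{P}}+\delta\,\mathbf{1}^T\mu$, respectively. Let $p\in(1,\infty]$ with dual exponent $q$ (i.e. $1/p+1/q=1$). If $\mu$ is $(\beta,p)$-smooth with respect to $\pi$, then $$\|\pi_\delta-\widetilde{\pi}_\delta\|_1\;\le\;\frac{C\,\varepsilon^{1/q}\log(1/\varepsilon)\,\beta}{\delta}.$$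
   Context: A Markov transition matrix on a finite set $\mathcal{X}$ is a matrix in $\mathbb{R}^{\mathcal{X}\times\mathcal{X}}$ with nonnegative entries and rows summing to one. Distributions are row vectors; $\mathbf{1}$ is the all-ones row vector, so $\mathbf{1}^T\mu$ is the matrix all of whose rows equal $\mu$. A distribution $\pi$ is stationary for $\mathsf{P}$ if $\pi\mathsf{P}=\pi$. $\varepsilon$-corruption: given $\mathsf{P}$ with stationary distribution $\pi$, a Markov transition matrix $\widetilde{\mathsf{P}}$ on $\mathcal{X}$ is an $\varepsilon$-corruption of $\mathsf{P}$ if $\sum_{x,y\in\mathcal{X}}\pi(x)\,|\mathsf{P}(x,y)-\widetilde{\mathsf{P}}(x,y)|\le\varepsilon$. Smoothness: $\mu$ is $(\beta,p)$-smooth with respect to $\pi$ if $\|\mu/\pi\|_{p,\pi}\le\beta$, where $\mu/\pi$ is the pointwise ratio, $\|f\|_{p,\pi}=\left(\sum_x\pi(x)|f(x)|^p\right)^{1/p}$ for $p<\infty$ and $\|f\|_{\infty,\pi}=\max_x|f(x)|$. $\|\cdot\|_1$ is the usual $\ell_1$ norm of vectors.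
   Formalization: As the bound fails at ε = 1 (the right side is 0) and no C works uniformly as ε → 1, it is proved for ε ≤ ε₀, for each ε₀ in (0,1), with C depending only on ε₀; at ε = 0 the right side is read as 0. State spaces are finite sets of natural numbers (any finite set up to relabelling). *)

theory Defs
  imports Complex_Main "HOL-Library.Extended_Real"
begin

text \<open>
  A state space is an explicit finite set \<open>X\<close>; vectors and matrices indexed by \<open>X\<close> are functions
  of which only the values on \<open>X\<close> matter. State spaces are not rendered as finite types, since
  an existentially quantified constant could then depend on the type, i.e. on the number of
  states.
\<close>

definition distribution :: "'a set \<Rightarrow> ('a \<Rightarrow> real) \<Rightarrow> bool" where
  "distribution X \<mu> \<longleftrightarrow> (\<forall>x\<in>X. 0 \<le> \<mu> x) \<and> (\<Sum>x\<in>X. \<mu> x) = 1"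

definition transition_matrix :: "'a set \<Rightarrow> ('a \<Rightarrow> 'a \<Rightarrow> real) \<Rightarrow> bool" where
  "transition_matrix X P \<longleftrightarrow> (\<forall>x\<in>X. (\<forall>y\<in>X. 0 \<le> P x y) \<and> (\<Sum>y\<in>X. P x y) = 1)"

definition stationary :: "'a set \<Rightarrow> ('a \<Rightarrow> 'a \<Rightarrow> real) \<Rightarrow> ('a \<Rightarrow> real) \<Rightarrow> bool" where
  "stationary X P \<pi> \<longleftrightarrow> distribution X \<pi> \<and> (\<forall>y\<in>X. (\<Sum>x\<in>X. \<pi> x * P x y) = \<pi> y)"

definition corruption ::
  "'a set \<Rightarrow> ('a \<Rightarrow> 'a \<Rightarrow> real) \<Rightarrow> ('a \<Rightarrow> real) \<Rightarrow> real \<Rightarrow> ('a \<Rightarrow> 'a \<Rightarrow> real) \<Rightarrow> bool" where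
  "corruption X P \<pi> \<epsilon> P' \<longleftrightarrow>
     transition_matrix X P' \<and> (\<Sum>x\<in>X. \<Sum>y\<in>X. \<pi> x * \<bar>P x y - P' x y\<bar>) \<le> \<epsilon>"

definition weighted_norm :: "'a set \<Rightarrow> ('a \<Rightarrow> real) \<Rightarrow> ereal \<Rightarrow> ('a \<Rightarrow> real) \<Rightarrow> real" where
  "weighted_norm X \<pi> p f =
     (if p = \<infinity> then Max ((\<lambda>x. \<bar>f x\<bar>) ` X)
      else (\<Sum>x\<in>X. \<pi> x * \<bar>f x\<bar> powr real_of_ereal p) powr (1 / real_of_ereal p))"

definition smooth ::
  "'a set \<Rightarrow> ('a \<Rightarrow> real) \<Rightarrow> real \<Rightarrow> ereal \<Rightarrow> ('a \<Rightarrow> real) \<Rightarrow> bool" where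
  "smooth X \<pi> \<beta> p \<mu> \<longleftrightarrow> weighted_norm X \<pi> p (\<lambda>x. \<mu> x / \<pi> x) \<le> \<beta>"

definition pagerank :: "('a \<Rightarrow> real) \<Rightarrow> real \<Rightarrow> ('a \<Rightarrow> 'a \<Rightarrow> real) \<Rightarrow> 'a \<Rightarrow> 'a \<Rightarrow> real" where
  "pagerank \<mu> \<delta> P = (\<lambda>x y. (1 - \<delta>) * P x y + \<delta> * \<mu> y)"

definition l1_norm :: "'a set \<Rightarrow> ('a \<Rightarrow> real) \<Rightarrow> real" where
  "l1_norm X f = (\<Sum>x\<in>X. \<bar>f x\<bar>)"

end

theory Submission
  imports Defs "HOL-Analysis.Convex"
begin

text \<open>
  Write \<open>d = \<pi>\<delta> - \<pi>\<delta>'\<close> and let \<open>e x\<close> be the \<open>\<ell>\<^sub>1\<close> distance between the rows \<open>P x\<close> and \<open>P' x\<close>.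
  Subtracting the two stationarity equations, the restart term \<open>\<delta> * \<mu>\<close> cancels and
  \<open>d = (1 - \<delta>) * (\<pi>\<delta> (P - P') + d P')\<close>. Since \<open>P'\<close> does not increase the \<open>\<ell>\<^sub>1\<close> norm, this gives
  \<open>\<delta> * \<parallel>d\<parallel> \<le> (1 - \<delta>) * (\<Sum>x. \<pi>\<delta> x * e x)\<close> (lemma \<open>pagerank_perturbation\<close>). The corruption hypothesis
  bounds the average of \<open>e\<close> under \<open>\<pi>\<close>, whereas here the average is under \<open>\<pi>\<delta>\<close>; what
  remains is a change of measure.

  For this, \<open>\<pi>\<delta>\<close> inherits the smoothness of \<open>\<mu>\<close>. The density \<open>f = \<pi>\<delta> / \<pi>\<close> is, at each point, a
  convex combination of values of \<open>f\<close> (with weights given by the time reversal of \<open>P\<close>, total mass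
  \<open>1 - \<delta>\<close>) and of the value of \<open>\<mu> / \<pi>\<close> (mass \<open>\<delta>\<close>). Applying Jensen's inequality and averaging
  over \<open>\<pi>\<close>, which the time reversal preserves, the \<open>\<pi>\<close>-average of \<open>\<phi> (f x)\<close> is at most that of
  \<open>\<phi> (\<mu> x / \<pi> x)\<close> for every convex \<open>\<phi>\<close> (lemma \<open>pagerank_density_convex_le\<close>). Taking
  \<open>\<phi> t = t powr p\<close> for finite \<open>p\<close>, and \<open>\<phi> t = max 0 (t - \<beta>)\<close> for \<open>p = \<infinity>\<close>, shows that \<open>\<pi>\<delta>\<close> is
  \<open>(\<beta>, p)\<close>-smooth.

  Finally, \<open>e \<le> 2\<close> because rows are distributions, so Hoelder's inequality for the weights
  \<open>\<pi> x * e x\<close>, of total mass at most \<open>\<epsilon>\<close>, gives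
  \<open>(\<Sum>x. \<pi> x * e x * f x) \<le> \<epsilon> powr (1 / q) * 2 powr (1 / p) * \<beta>\<close>. Altogether
  \<open>\<parallel>d\<parallel> \<le> 2 * \<epsilon> powr (1 / q) * \<beta> / \<delta>\<close>, and \<open>ln (1 / \<epsilon>)\<close> is at least the positive constant
  \<open>ln (1 / \<epsilon>0)\<close>, unless \<open>\<epsilon> = 0\<close>, when both sides vanish.
\<close>

section \<open>Convex functions and a weighted power mean inequality\<close>

lemma convex_on_powr_nonneg:
  fixes p :: real
  assumes "p \<ge> 1"
  shows "convex_on {0..} (\<lambda>x. x powr p)"
proof -
  have scale: "(v * y) powr p \<le> v * y powr p" if "0 < v" "v < 1" "0 \<le> y" for v y :: real
  proof -
    have "v powr p \<le> v powr 1"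
      using that assms by (intro powr_mono') auto
    then show ?thesis
      using that by (simp add: powr_mult mult_right_mono)
  qed
  show ?thesis
  proof (rule convex_onI)
    fix t x y :: real
    assume t: "0 < t" "t < 1" and xy: "x \<in> {0..}" "y \<in> {0..}"
    consider "x = 0" | "y = 0" | "0 < x" "0 < y"
      using xy by fastforce
    then show "((1 - t) *\<^sub>R x + t *\<^sub>R y) powr p \<le> (1 - t) * x powr p + t * y powr p"
    proof cases
      case 3
      then show ?thesis
        using convex_onD[OF powr_convex[OF assms], of t x y] t by simp
    qed (use scale[of t y] scale[of "1 - t" x] t xy in auto)
  qed simp
qed

lemma convex_on_positive_part: "convex_on A (\<lambda>x::real. max 0 (x - b))" if "convex A"
proof (rule convex_onI)
  fix t x y :: real
  assume t: "0 < t" "t < 1"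
  have "0 \<le> (1 - t) * max 0 (x - b) + t * max 0 (y - b)"
    using t by simp
  moreover have "(1 - t) * (x - b) + t * (y - b) \<le> (1 - t) * max 0 (x - b) + t * max 0 (y - b)"
    using t by (intro add_mono mult_left_mono) auto
  ultimately show "max 0 ((1 - t) *\<^sub>R x + t *\<^sub>R y - b)
      \<le> (1 - t) * max 0 (x - b) + t * max 0 (y - b)"
    unfolding real_scaleR_def by (intro max.boundedI) (simp_all add: algebra_simps)
qed (rule that)

text \<open>
  Hoelder's inequality against the constant function 1. After normalising the weights to total
  mass 1 it is Jensen's inequality for \<open>t powr p\<close>.
\<close>

lemma weighted_sum_le_powr:
  fixes w f :: "'a \<Rightarrow> real" and p :: real
  assumes fin: "finite X" and p: "1 \<le> p"
    and w: "\<And>x. x \<in> X \<Longrightarrow> 0 \<le> w x" and f: "\<And>x. x \<in> X \<Longrightarrow> 0 \<le> f x"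
  shows "(\<Sum>x\<in>X. w x * f x)
    \<le> (\<Sum>x\<in>X. w x) powr (1 - 1 / p) * (\<Sum>x\<in>X. w x * f x powr p) powr (1 / p)"
proof -
  define S where "S = (\<Sum>x\<in>X. w x)"
  define F where "F = (\<Sum>x\<in>X. w x * f x powr p)"
  have F0: "0 \<le> F"
    unfolding F_def using w by (intro sum_nonneg) auto
  have S0: "0 \<le> S"
    unfolding S_def using w by (rule sum_nonneg)
  show ?thesis
  proof (cases "S = 0")
    case True
    then have "\<forall>x\<in>X. w x = 0"
      unfolding S_def using sum_nonneg_eq_0_iff[OF fin, of w] w by auto
    then show ?thesis by simp
  next
    case False
    then have S: "0 < S" using S0 by simp
    then have ne: "X \<noteq> {}" unfolding S_def by auto
    define A where "A = (\<Sum>x\<in>X. w x * f x)"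
    have A0: "0 \<le> A"
      unfolding A_def using w f by (intro sum_nonneg) auto
    have "(\<Sum>x\<in>X. (w x / S) *\<^sub>R f x) powr p \<le> (\<Sum>x\<in>X. (w x / S) * f x powr p)"
      by (rule convex_on_sum[OF fin ne convex_on_powr_nonneg[OF p]])
        (use w f S in \<open>auto simp: S_def sum_divide_distrib[symmetric]\<close>)
    then have "(A / S) powr p \<le> F / S"
      by (simp add: A_def F_def sum_divide_distrib)
    then have "((A / S) powr p) powr (1 / p) \<le> (F / S) powr (1 / p)"
      using p by (intro powr_mono2) auto
    then have "A / S \<le> F powr (1 / p) / S powr (1 / p)"
      using p A0 S F0 by (simp add: powr_powr powr_divide)
    then have "A \<le> S * (F powr (1 / p) / S powr (1 / p))"
      using S by (simp add: field_simps)
    also have "\<dots> = S powr (1 - 1 / p) * F powr (1 / p)"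
      using S by (simp add: powr_diff)
    finally show ?thesis
      by (simp add: A_def S_def F_def)
  qed
qed

section \<open>Sensitivity of PageRank to the transition matrix\<close>

lemma transition_matrix_l1_le:
  assumes fin: "finite X" and P: "transition_matrix X P"
  shows "(\<Sum>y\<in>X. \<bar>\<Sum>x\<in>X. v x * P x y\<bar>) \<le> (\<Sum>x\<in>X. \<bar>v x\<bar>)"
proof -
  have "(\<Sum>y\<in>X. \<bar>\<Sum>x\<in>X. v x * P x y\<bar>) \<le> (\<Sum>y\<in>X. \<Sum>x\<in>X. \<bar>v x\<bar> * P x y)"
  proof (rule sum_mono)
    fix y assume y: "y \<in> X"
    have "\<bar>\<Sum>x\<in>X. v x * P x y\<bar> \<le> (\<Sum>x\<in>X. \<bar>v x * P x y\<bar>)"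
      by (rule sum_abs)
    also have "\<dots> = (\<Sum>x\<in>X. \<bar>v x\<bar> * P x y)"
      using P y by (intro sum.cong) (auto simp: abs_mult transition_matrix_def)
    finally show "\<bar>\<Sum>x\<in>X. v x * P x y\<bar> \<le> (\<Sum>x\<in>X. \<bar>v x\<bar> * P x y)" .
  qed
  also have "\<dots> = (\<Sum>x\<in>X. \<bar>v x\<bar> * (\<Sum>y\<in>X. P x y))"
    by (subst sum.swap) (simp add: sum_distrib_left)
  also have "\<dots> = (\<Sum>x\<in>X. \<bar>v x\<bar>)"
    using P by (intro sum.cong) (auto simp: transition_matrix_def)
  finally show ?thesis .
qed

lemma stationary_pagerank_eq:
  assumes "stationary X (pagerank \<mu> \<delta> P) \<nu>" and "y \<in> X"
  shows "\<nu> y = (1 - \<delta>) * (\<Sum>x\<in>X. \<nu> x * P x y) + \<delta> * \<mu> y"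
proof -
  have "\<nu> y = (\<Sum>x\<in>X. \<nu> x * ((1 - \<delta>) * P x y + \<delta> * \<mu> y))"
    using assms by (simp add: stationary_def pagerank_def)
  also have "\<dots> = (1 - \<delta>) * (\<Sum>x\<in>X. \<nu> x * P x y) + (\<Sum>x\<in>X. \<nu> x) * (\<delta> * \<mu> y)"
    by (simp add: sum_distrib_left sum_distrib_right sum.distrib distrib_left mult.left_commute)
  finally show ?thesis
    using assms by (simp add: stationary_def distribution_def)
qed

text \<open>
  The restart makes the corrupted chain an \<open>\<ell>\<^sub>1\<close> contraction with factor \<open>1 - \<delta>\<close> on differences of
  distributions, so the one-step discrepancy is amplified by at most \<open>1 / \<delta>\<close>.
\<close>

lemma pagerank_perturbation:
  assumes fin: "finite X" and P': "transition_matrix X P'" and \<delta>: "\<delta> \<le> 1"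
    and \<nu>: "stationary X (pagerank \<mu> \<delta> P) \<nu>" and \<nu>': "stationary X (pagerank \<mu> \<delta> P') \<nu>'"
  shows "\<delta> * l1_norm X (\<lambda>x. \<nu> x - \<nu>' x)
    \<le> (1 - \<delta>) * (\<Sum>x\<in>X. \<nu> x * (\<Sum>y\<in>X. \<bar>P x y - P' x y\<bar>))"
proof -
  define D where "D = l1_norm X (\<lambda>x. \<nu> x - \<nu>' x)"
  define E where "E = (\<Sum>x\<in>X. \<nu> x * (\<Sum>y\<in>X. \<bar>P x y - P' x y\<bar>))"
  have \<nu>0: "\<And>x. x \<in> X \<Longrightarrow> 0 \<le> \<nu> x"
    using \<nu> by (simp add: stationary_def distribution_def)
  have split: "\<nu> y - \<nu>' y = (1 - \<delta>) *
      ((\<Sum>x\<in>X. \<nu> x * (P x y - P' x y)) + (\<Sum>x\<in>X. (\<nu> x - \<nu>' x) * P' x y))" if "y \<in> X" for y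
    unfolding stationary_pagerank_eq[OF \<nu> that] stationary_pagerank_eq[OF \<nu>' that]
    by (simp add: sum_subtractf algebra_simps)
  have "D = (\<Sum>y\<in>X. (1 - \<delta>) *
      \<bar>(\<Sum>x\<in>X. \<nu> x * (P x y - P' x y)) + (\<Sum>x\<in>X. (\<nu> x - \<nu>' x) * P' x y)\<bar>)"
    unfolding D_def l1_norm_def using \<delta> by (intro sum.cong refl) (subst split, auto simp: abs_mult)
  also have "\<dots> \<le> (\<Sum>y\<in>X. (1 - \<delta>) *
      ((\<Sum>x\<in>X. \<nu> x * \<bar>P x y - P' x y\<bar>) + \<bar>\<Sum>x\<in>X. (\<nu> x - \<nu>' x) * P' x y\<bar>))"
  proof (intro sum_mono mult_left_mono)
    fix y assume "y \<in> X"
    have "\<bar>\<Sum>x\<in>X. \<nu> x * (P x y - P' x y)\<bar> \<le> (\<Sum>x\<in>X. \<bar>\<nu> x * (P x y - P' x y)\<bar>)"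
      by (rule sum_abs)
    also have "\<dots> = (\<Sum>x\<in>X. \<nu> x * \<bar>P x y - P' x y\<bar>)"
      using \<nu>0 by (intro sum.cong) (auto simp: abs_mult)
    finally show "\<bar>(\<Sum>x\<in>X. \<nu> x * (P x y - P' x y)) + (\<Sum>x\<in>X. (\<nu> x - \<nu>' x) * P' x y)\<bar>
        \<le> (\<Sum>x\<in>X. \<nu> x * \<bar>P x y - P' x y\<bar>) + \<bar>\<Sum>x\<in>X. (\<nu> x - \<nu>' x) * P' x y\<bar>"
      by linarith
  qed (use \<delta> in simp)
  also have "\<dots> = (1 - \<delta>) * ((\<Sum>y\<in>X. \<Sum>x\<in>X. \<nu> x * \<bar>P x y - P' x y\<bar>)
      + (\<Sum>y\<in>X. \<bar>\<Sum>x\<in>X. (\<nu> x - \<nu>' x) * P' x y\<bar>))"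
    by (simp add: sum_distrib_left[symmetric] sum.distrib)
  also have "(\<Sum>y\<in>X. \<Sum>x\<in>X. \<nu> x * \<bar>P x y - P' x y\<bar>) = E"
    unfolding E_def by (subst sum.swap) (simp add: sum_distrib_left)
  also have "(1 - \<delta>) * (E + (\<Sum>y\<in>X. \<bar>\<Sum>x\<in>X. (\<nu> x - \<nu>' x) * P' x y\<bar>)) \<le> (1 - \<delta>) * (E + D)"
    unfolding D_def l1_norm_def using \<delta>
    by (intro mult_left_mono add_left_mono transition_matrix_l1_le[OF fin P']) auto
  finally show ?thesis
    unfolding D_def[symmetric] E_def[symmetric] by (simp add: algebra_simps)
qed

section \<open>Smoothness of the PageRank distribution\<close>

text \<open>
  With \<open>f = \<nu> / \<pi>\<close> and \<open>g = \<mu> / \<pi>\<close>, stationarity of \<open>\<nu>\<close> reads \<open>f = (1 - \<delta>) * R f + \<delta> * g\<close>, where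
  \<open>R y x = \<pi> x * P x y / \<pi> y\<close> is the time reversal of \<open>P\<close>: its rows sum to 1 by stationarity of
  \<open>\<pi>\<close>, and it preserves \<open>\<pi>\<close>. Jensen and averaging over \<open>\<pi>\<close> bound the average of \<open>\<phi> f\<close> by
  \<open>1 - \<delta>\<close> times itself plus \<open>\<delta>\<close> times the average of \<open>\<phi> g\<close>; the former is absorbed because
  \<open>\<delta> > 0\<close>.
\<close>

lemma pagerank_density_convex_le:
  fixes \<phi> :: "real \<Rightarrow> real"
  assumes fin: "finite X" and P: "transition_matrix X P" and \<pi>: "stationary X P \<pi>"
    and pos: "\<forall>x\<in>X. 0 < \<pi> x" and \<delta>: "0 < \<delta>" "\<delta> \<le> 1" and \<mu>: "distribution X \<mu>"
    and \<nu>: "stationary X (pagerank \<mu> \<delta> P) \<nu>" and \<phi>: "convex_on {0..} \<phi>"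
  shows "(\<Sum>x\<in>X. \<pi> x * \<phi> (\<nu> x / \<pi> x)) \<le> (\<Sum>x\<in>X. \<pi> x * \<phi> (\<mu> x / \<pi> x))"
proof -
  define f where "f = (\<lambda>x. \<nu> x / \<pi> x)"
  define g where "g = (\<lambda>x. \<mu> x / \<pi> x)"
  define R where "R = (\<lambda>y x. \<pi> x * P x y / \<pi> y)"
  have f0: "0 \<le> f x" and g0: "0 \<le> g x" if "x \<in> X" for x
    using \<nu> \<mu> pos that
    by (auto simp: f_def g_def stationary_def distribution_def intro!: divide_nonneg_pos)
  have R0: "0 \<le> R y x" if "x \<in> X" "y \<in> X" for x y
    using P pos that by (auto simp: R_def transition_matrix_def intro!: divide_nonneg_pos)
  have R1: "(\<Sum>x\<in>X. R y x) = 1" if "y \<in> X" for y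
  proof -
    have "0 < \<pi> y" "(\<Sum>x\<in>X. \<pi> x * P x y) = \<pi> y"
      using \<pi> pos that by (auto simp: stationary_def)
    then show ?thesis
      by (simp add: R_def sum_divide_distrib[symmetric])
  qed
  have fixpoint: "f y = (1 - \<delta>) * (\<Sum>x\<in>X. R y x * f x) + \<delta> * g y" if y: "y \<in> X" for y
  proof -
    have "(\<Sum>x\<in>X. R y x * f x) = (\<Sum>x\<in>X. \<nu> x * P x y) / \<pi> y"
      unfolding sum_divide_distrib
    proof (rule sum.cong)
      fix x assume "x \<in> X"
      then have "\<pi> x \<noteq> 0" using pos by force
      then show "R y x * f x = \<nu> x * P x y / \<pi> y"
        by (simp add: R_def f_def)
    qed simp
    moreover have "f y = ((1 - \<delta>) * (\<Sum>x\<in>X. \<nu> x * P x y) + \<delta> * \<mu> y) / \<pi> y"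
      using stationary_pagerank_eq[OF \<nu> y] by (simp add: f_def)
    ultimately show ?thesis
      by (simp add: g_def add_divide_distrib)
  qed
  have jensen: "\<phi> (f y) \<le> (1 - \<delta>) * (\<Sum>x\<in>X. R y x * \<phi> (f x)) + \<delta> * \<phi> (g y)" if y: "y \<in> X" for y
  proof -
    have "0 \<le> (\<Sum>x\<in>X. R y x * f x)"
      using y f0 R0 by (intro sum_nonneg) auto
    then have "\<phi> (f y) \<le> (1 - \<delta>) * \<phi> (\<Sum>x\<in>X. R y x * f x) + \<delta> * \<phi> (g y)"
      unfolding fixpoint[OF y]
      using convex_onD[OF \<phi>, of \<delta> "\<Sum>x\<in>X. R y x * f x" "g y"] \<delta> g0[OF y] by simp
    moreover have "\<phi> (\<Sum>x\<in>X. R y x * f x) \<le> (\<Sum>x\<in>X. R y x * \<phi> (f x))"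
      using convex_on_sum[OF fin _ \<phi> R1[OF y], of f] y R0 f0 by auto
    ultimately show ?thesis
      using \<delta> by (smt (verit) mult_left_mono)
  qed
  define F where "F = (\<Sum>x\<in>X. \<pi> x * \<phi> (f x))"
  define G where "G = (\<Sum>x\<in>X. \<pi> x * \<phi> (g x))"
  have "F \<le> (\<Sum>y\<in>X. \<pi> y * ((1 - \<delta>) * (\<Sum>x\<in>X. R y x * \<phi> (f x)) + \<delta> * \<phi> (g y)))"
    unfolding F_def using pos jensen by (intro sum_mono mult_left_mono) (auto intro: less_imp_le)
  also have "\<dots> = (1 - \<delta>) * (\<Sum>y\<in>X. \<pi> y * (\<Sum>x\<in>X. R y x * \<phi> (f x))) + \<delta> * G"
    unfolding G_def by (simp add: distrib_left sum.distrib sum_distrib_left mult.left_commute)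
  also have "(\<Sum>y\<in>X. \<pi> y * (\<Sum>x\<in>X. R y x * \<phi> (f x))) = (\<Sum>y\<in>X. \<Sum>x\<in>X. \<pi> x * \<phi> (f x) * P x y)"
    unfolding sum_distrib_left
  proof (intro sum.cong refl)
    fix x y assume "y \<in> X"
    then have "\<pi> y \<noteq> 0" using pos by force
    then show "\<pi> y * (R y x * \<phi> (f x)) = \<pi> x * \<phi> (f x) * P x y"
      by (simp add: R_def)
  qed
  also have "\<dots> = (\<Sum>x\<in>X. \<pi> x * \<phi> (f x) * (\<Sum>y\<in>X. P x y))"
    by (subst sum.swap) (simp add: sum_distrib_left)
  also have "\<dots> = F"
    unfolding F_def using P by (intro sum.cong) (auto simp: transition_matrix_def)
  finally have "\<delta> * F \<le> \<delta> * G"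
    by (simp add: algebra_simps)
  then show ?thesis
    using \<delta> by (simp add: F_def G_def f_def g_def)
qed

text \<open>
  On an empty \<open>X\<close> the maximum norm would be the unspecified value \<open>Max {}\<close>.
\<close>

lemma weighted_norm_nonneg:
  assumes "finite X" "X \<noteq> {}"
  shows "0 \<le> weighted_norm X \<pi> p f"
proof -
  obtain x where "x \<in> X" using assms by auto
  then have "0 \<le> Max ((\<lambda>x. \<bar>f x\<bar>) ` X)"
    using assms by (intro order_trans[OF abs_ge_zero Max_ge]) auto
  then show ?thesis by (simp add: weighted_norm_def)
qed

text \<open>
  The weighted norm of the density of \<open>\<nu>\<close> is bounded by applying the preceding lemma to a convex
  function that detects the norm: \<open>t powr p\<close>, or \<open>max 0 (t - \<beta>)\<close>, whose average vanishes exactly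
  when the density is bounded by \<open>\<beta>\<close>.
\<close>

lemma smooth_pagerank:
  assumes fin: "finite X" and P: "transition_matrix X P" and \<pi>: "stationary X P \<pi>"
    and pos: "\<forall>x\<in>X. 0 < \<pi> x" and \<delta>: "0 < \<delta>" "\<delta> \<le> 1" and \<mu>: "distribution X \<mu>"
    and \<nu>: "stationary X (pagerank \<mu> \<delta> P) \<nu>" and p: "1 < p" and sm: "smooth X \<pi> \<beta> p \<mu>"
  shows "smooth X \<pi> \<beta> p \<nu>"
proof -
  note le = pagerank_density_convex_le[OF fin P \<pi> pos \<delta> \<mu> \<nu>]
  have ne: "X \<noteq> {}"
    using \<mu> by (auto simp: distribution_def)
  have \<nu>0: "0 \<le> \<nu> x / \<pi> x" and \<mu>0: "0 \<le> \<mu> x / \<pi> x" if "x \<in> X" for x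
    using \<nu> \<mu> pos that by (auto simp: stationary_def distribution_def intro!: divide_nonneg_pos)
  show ?thesis
  proof (cases "p = \<infinity>")
    case True
    have \<mu>_le: "\<mu> x / \<pi> x \<le> \<beta>" if "x \<in> X" for x
    proof -
      have "\<mu> x / \<pi> x \<le> \<bar>\<mu> x / \<pi> x\<bar>"
        by (rule abs_ge_self)
      also have "\<dots> \<le> Max ((\<lambda>x. \<bar>\<mu> x / \<pi> x\<bar>) ` X)"
        using fin that by (intro Max_ge) auto
      also have "\<dots> \<le> \<beta>"
        using sm True by (simp add: smooth_def weighted_norm_def)
      finally show ?thesis .
    qed
    have "(\<Sum>x\<in>X. \<pi> x * max 0 (\<nu> x / \<pi> x - \<beta>)) \<le> (\<Sum>x\<in>X. \<pi> x * max 0 (\<mu> x / \<pi> x - \<beta>))"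
      by (rule le) (simp add: convex_on_positive_part)
    also have "\<dots> = 0"
      using \<mu>_le by (intro sum.neutral) auto
    finally have "(\<Sum>x\<in>X. \<pi> x * max 0 (\<nu> x / \<pi> x - \<beta>)) = 0"
      using pos by (intro antisym sum_nonneg) (auto intro: less_imp_le)
    then have zero: "\<forall>x\<in>X. \<pi> x * max 0 (\<nu> x / \<pi> x - \<beta>) = 0"
      using pos by (subst (asm) sum_nonneg_eq_0_iff[OF fin]) (auto intro: less_imp_le)
    have "\<bar>\<nu> x / \<pi> x\<bar> \<le> \<beta>" if "x \<in> X" for x
    proof -
      have "max 0 (\<nu> x / \<pi> x - \<beta>) = 0" using zero pos that by force
      then show ?thesis using \<nu>0[OF that] by linarith
    qed
    then have "Max ((\<lambda>x. \<bar>\<nu> x / \<pi> x\<bar>) ` X) \<le> \<beta>"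
      using fin ne by (intro Max.boundedI) auto
    then show ?thesis
      using True by (simp add: smooth_def weighted_norm_def)
  next
    case False
    then obtain r where r: "p = ereal r" "1 < r"
      using p by (cases p) auto
    have "(\<Sum>x\<in>X. \<pi> x * (\<nu> x / \<pi> x) powr r) \<le> (\<Sum>x\<in>X. \<pi> x * (\<mu> x / \<pi> x) powr r)"
      by (rule le) (use r in \<open>simp add: convex_on_powr_nonneg\<close>)
    then have "(\<Sum>x\<in>X. \<pi> x * \<bar>\<nu> x / \<pi> x\<bar> powr r) \<le> (\<Sum>x\<in>X. \<pi> x * \<bar>\<mu> x / \<pi> x\<bar> powr r)"
      using \<nu>0 \<mu>0 by (simp add: abs_of_nonneg del: abs_divide cong: sum.cong)
    then have "weighted_norm X \<pi> p (\<lambda>x. \<nu> x / \<pi> x) \<le> weighted_norm X \<pi> p (\<lambda>x. \<mu> x / \<pi> x)"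
      unfolding weighted_norm_def using r pos
      by (auto intro!: powr_mono2 sum_nonneg intro: less_imp_le)
    then show ?thesis
      using sm by (simp add: smooth_def)
  qed
qed

section \<open>Change of measure and the corruption bound\<close>

text \<open>
  A function that is small on \<open>\<pi>\<close>-average and bounded is small on average under a smooth
  distribution: Hoelder with the weights \<open>\<pi> x * e x\<close>, where the bound \<open>2\<close> converts the
  \<open>p\<close>-norm of the density under these weights into its \<open>p\<close>-norm under \<open>\<pi>\<close>.
\<close>

lemma smooth_average_le:
  assumes fin: "finite X" and pos: "\<forall>x\<in>X. 0 < \<pi> x" and \<nu>: "distribution X \<nu>"
    and p: "1 < p" and pq: "1 / p + 1 / ereal q = 1" and sm: "smooth X \<pi> \<beta> p \<nu>"
    and e: "\<And>x. x \<in> X \<Longrightarrow> 0 \<le> e x" "\<And>x. x \<in> X \<Longrightarrow> e x \<le> 2"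
    and avg: "(\<Sum>x\<in>X. \<pi> x * e x) \<le> \<epsilon>"
  shows "(\<Sum>x\<in>X. \<nu> x * e x) \<le> 2 * \<epsilon> powr (1 / q) * \<beta>"
proof -
  have ne: "X \<noteq> {}"
    using \<nu> by (auto simp: distribution_def)
  define S where "S = (\<Sum>x\<in>X. \<pi> x * e x)"
  define f where "f = (\<lambda>x. \<nu> x / \<pi> x)"
  have f0: "0 \<le> f x" if "x \<in> X" for x
    using \<nu> pos that by (auto simp: f_def distribution_def intro!: divide_nonneg_pos)
  have w0: "0 \<le> \<pi> x * e x" if "x \<in> X" for x
    using pos e(1) that by (auto intro: less_imp_le)
  have S0: "0 \<le> S"
    unfolding S_def using w0 by (rule sum_nonneg)
  have \<beta>: "weighted_norm X \<pi> p f \<le> \<beta>"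
    using sm by (simp add: smooth_def f_def)
  then have \<beta>0: "0 \<le> \<beta>"
    using weighted_norm_nonneg[OF fin ne, of \<pi> p f] by linarith
  have density: "(\<Sum>x\<in>X. \<nu> x * e x) = (\<Sum>x\<in>X. \<pi> x * e x * f x)"
  proof (rule sum.cong)
    fix x assume "x \<in> X"
    then have "\<pi> x \<noteq> 0" using pos by force
    then show "\<nu> x * e x = \<pi> x * e x * f x" by (simp add: f_def)
  qed simp
  \<comment> \<open>For \<open>q = 0\<close> the term \<open>1 / ereal q\<close> is infinite, so the duality equation excludes it.\<close>
  have q: "q \<noteq> 0"
    using pq p by (cases p) (auto simp: divide_ereal_def)
  show ?thesis
  proof (cases "p = \<infinity>")
    case True
    then have q1: "q = 1"
      using pq q by (simp add: one_ereal_def)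
    have "f x \<le> \<beta>" if "x \<in> X" for x
    proof -
      have "\<bar>f x\<bar> \<le> Max ((\<lambda>x. \<bar>f x\<bar>) ` X)"
        using fin that by (intro Max_ge) auto
      then show ?thesis
        using \<beta> True by (simp add: weighted_norm_def)
    qed
    then have "(\<Sum>x\<in>X. \<pi> x * e x * f x) \<le> (\<Sum>x\<in>X. \<pi> x * e x * \<beta>)"
      using w0 by (intro sum_mono mult_left_mono)
    also have "\<dots> = S * \<beta>"
      by (simp add: S_def sum_distrib_right)
    also have "\<dots> \<le> 2 * \<epsilon> * \<beta>"
      using avg S0 \<beta>0 by (intro mult_right_mono) (auto simp: S_def)
    finally show ?thesis
      using density q1 avg S0 by (simp add: S_def)
  next
    case False
    then obtain r where r: "p = ereal r" "1 < r"
      using p by (cases p) auto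
    have dual: "1 / q = 1 - 1 / r"
      using pq r q by (simp add: one_ereal_def)
    have q0: "0 \<le> 1 / q"
      using dual r by simp
    have norm: "(\<Sum>x\<in>X. \<pi> x * f x powr r) powr (1 / r) \<le> \<beta>"
    proof -
      have "(\<Sum>x\<in>X. \<pi> x * f x powr r) = (\<Sum>x\<in>X. \<pi> x * \<bar>f x\<bar> powr r)"
        using f0 by (intro sum.cong) (auto simp: abs_of_nonneg)
      then show ?thesis
        using \<beta> r by (simp add: weighted_norm_def)
    qed
    have "(\<Sum>x\<in>X. \<pi> x * e x * f x powr r) \<le> (\<Sum>x\<in>X. 2 * (\<pi> x * f x powr r))"
    proof (rule sum_mono)
      fix x assume x: "x \<in> X"
      have "e x * (\<pi> x * f x powr r) \<le> 2 * (\<pi> x * f x powr r)"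
        using e(2)[OF x] pos x by (intro mult_right_mono) (auto intro: less_imp_le)
      then show "\<pi> x * e x * f x powr r \<le> 2 * (\<pi> x * f x powr r)"
        by (simp add: mult_ac)
    qed
    then have "(\<Sum>x\<in>X. \<pi> x * e x * f x powr r) \<le> 2 * (\<Sum>x\<in>X. \<pi> x * f x powr r)"
      by (simp add: sum_distrib_left)
    then have "(\<Sum>x\<in>X. \<pi> x * e x * f x powr r) powr (1 / r)
        \<le> (2 * (\<Sum>x\<in>X. \<pi> x * f x powr r)) powr (1 / r)"
      using r w0 by (intro powr_mono2) (auto intro!: sum_nonneg)
    also have "\<dots> = 2 powr (1 / r) * (\<Sum>x\<in>X. \<pi> x * f x powr r) powr (1 / r)"
      using pos by (intro powr_mult)
    also have "\<dots> \<le> 2 powr 1 * \<beta>"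
      using norm r by (intro mult_mono powr_mono) auto
    finally have moment: "(\<Sum>x\<in>X. \<pi> x * e x * f x powr r) powr (1 / r) \<le> 2 * \<beta>"
      by simp
    have "(\<Sum>x\<in>X. \<pi> x * e x * f x)
        \<le> S powr (1 - 1 / r) * (\<Sum>x\<in>X. \<pi> x * e x * f x powr r) powr (1 / r)"
      unfolding S_def using fin r w0 f0 by (intro weighted_sum_le_powr) auto
    also have "\<dots> \<le> \<epsilon> powr (1 / q) * (2 * \<beta>)"
      unfolding dual[symmetric]
      using avg S0 q0 moment by (intro mult_mono powr_mono2) (auto simp: S_def)
    finally show ?thesis
      by (simp add: density mult_ac)
  qed
qed

theorem corollary3p3:
  fixes \<epsilon>0 :: real
  assumes "0 < \<epsilon>0" and "\<epsilon>0 < 1"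
  shows "\<exists>C>0. \<forall>(X :: nat set) P P' \<pi> \<epsilon> \<delta> \<mu> \<pi>\<delta> \<pi>\<delta>' (p :: ereal) (q :: real) \<beta>.
    finite X \<longrightarrow>
    transition_matrix X P \<longrightarrow>
    stationary X P \<pi> \<longrightarrow>
    (\<forall>x\<in>X. 0 < \<pi> x) \<longrightarrow>
    \<epsilon> \<le> \<epsilon>0 \<longrightarrow>
    corruption X P \<pi> \<epsilon> P' \<longrightarrow>
    0 < \<delta> \<longrightarrow> \<delta> \<le> 1 \<longrightarrow>
    distribution X \<mu> \<longrightarrow>
    stationary X (pagerank \<mu> \<delta> P) \<pi>\<delta> \<longrightarrow>
    stationary X (pagerank \<mu> \<delta> P') \<pi>\<delta>' \<longrightarrow>
    1 < p \<longrightarrow> 1 / p + 1 / ereal q = 1 \<longrightarrow>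
    smooth X \<pi> \<beta> p \<mu> \<longrightarrow>
    l1_norm X (\<lambda>x. \<pi>\<delta> x - \<pi>\<delta>' x) \<le> C * \<epsilon> powr (1 / q) * ln (1 / \<epsilon>) * \<beta> / \<delta>"
proof (intro exI[of _ "2 / ln (1 / \<epsilon>0)"] conjI allI impI)
  have L0: "0 < ln (1 / \<epsilon>0)"
    using assms by (intro ln_gt_zero) simp
  then show "0 < 2 / ln (1 / \<epsilon>0)" by simp
  fix X :: "nat set" and P P' \<pi> \<epsilon> \<delta> \<mu> \<pi>\<delta> \<pi>\<delta>' and p :: ereal and q \<beta> :: real
  assume fin: "finite X" and P: "transition_matrix X P" and \<pi>: "stationary X P \<pi>"
    and pos: "\<forall>x\<in>X. 0 < \<pi> x" and \<epsilon>: "\<epsilon> \<le> \<epsilon>0" and corr: "corruption X P \<pi> \<epsilon> P'"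
    and \<delta>: "0 < \<delta>" "\<delta> \<le> 1" and \<mu>: "distribution X \<mu>"
    and \<nu>: "stationary X (pagerank \<mu> \<delta> P) \<pi>\<delta>" and \<nu>': "stationary X (pagerank \<mu> \<delta> P') \<pi>\<delta>'"
    and p: "1 < p" and pq: "1 / p + 1 / ereal q = 1" and sm: "smooth X \<pi> \<beta> p \<mu>"
  define e where "e = (\<lambda>x. \<Sum>y\<in>X. \<bar>P x y - P' x y\<bar>)"
  define B where "B = \<epsilon> powr (1 / q) * \<beta>"
  have P': "transition_matrix X P'" and avg: "(\<Sum>x\<in>X. \<pi> x * e x) \<le> \<epsilon>"
    using corr by (auto simp: corruption_def e_def sum_distrib_left)
  have e0: "0 \<le> e x" for x
    unfolding e_def by (intro sum_nonneg) auto
  have e2: "e x \<le> 2" if "x \<in> X" for x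
  proof -
    have "e x \<le> (\<Sum>y\<in>X. P x y + P' x y)"
      unfolding e_def using P P' that by (intro sum_mono) (fastforce simp: transition_matrix_def abs_le_iff)
    also have "\<dots> = 2"
      using P P' that by (simp add: sum.distrib transition_matrix_def)
    finally show ?thesis .
  qed
  have \<epsilon>0: "0 \<le> \<epsilon>"
    using avg pos e0 by (auto intro!: order_trans[OF sum_nonneg avg] intro: less_imp_le)
  have \<nu>_dist: "distribution X \<pi>\<delta>"
    using \<nu> by (simp add: stationary_def)
  have "(\<Sum>x\<in>X. \<pi>\<delta> x * e x) \<le> 2 * B"
    using smooth_average_le[OF fin pos \<nu>_dist p pq smooth_pagerank[OF fin P \<pi> pos \<delta> \<mu> \<nu> p sm] e0 e2 avg]
    by (simp add: B_def)
  moreover have "0 \<le> (\<Sum>x\<in>X. \<pi>\<delta> x * e x)"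
    using \<nu>_dist e0 by (intro sum_nonneg) (auto simp: distribution_def)
  ultimately have "(1 - \<delta>) * (\<Sum>x\<in>X. \<pi>\<delta> x * e x) \<le> 2 * B" and B0: "0 \<le> B"
    using \<delta> mult_left_le_one_le[of "\<Sum>x\<in>X. \<pi>\<delta> x * e x" "1 - \<delta>"] by auto
  then have "\<delta> * l1_norm X (\<lambda>x. \<pi>\<delta> x - \<pi>\<delta>' x) \<le> 2 * B"
    using pagerank_perturbation[OF fin P' \<delta>(2) \<nu> \<nu>'] by (simp add: e_def)
  also have "\<dots> \<le> 2 / ln (1 / \<epsilon>0) * ln (1 / \<epsilon>) * B"
  proof (cases "\<epsilon> = 0")
    \<comment> \<open>Here \<open>B = 0\<close> because \<open>0 powr (1 / q) = 0\<close>, whatever the value of \<open>ln (1 / 0)\<close>.\<close>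
    case True
    then show ?thesis by (simp add: B_def)
  next
    case False
    then have "ln (1 / \<epsilon>0) \<le> ln (1 / \<epsilon>)"
      using \<epsilon> \<epsilon>0 assms by (intro ln_mono) (auto simp: field_simps)
    then have "1 \<le> ln (1 / \<epsilon>) / ln (1 / \<epsilon>0)"
      using L0 by simp
    then have "2 * B * 1 \<le> 2 * B * (ln (1 / \<epsilon>) / ln (1 / \<epsilon>0))"
      using B0 by (intro mult_left_mono) auto
    then show ?thesis by (simp add: mult_ac)
  qed
  finally show "l1_norm X (\<lambda>x. \<pi>\<delta> x - \<pi>\<delta>' x)
      \<le> 2 / ln (1 / \<epsilon>0) * \<epsilon> powr (1 / q) * ln (1 / \<epsilon>) * \<beta> / \<delta>"
    by (subst pos_le_divide_eq[OF \<delta>(1)]) (simp add: B_def mult_ac)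
qed

end
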